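(* Let $\lambda/\mu$ be a skew shape of size $n$, and let $P_{\lambda/\mu}$ be its cell poset. Then all coefficients of the order polynomial $\Omega(P_{\lambda/\mu};t)\in\mathbb{Q}[t]$ (in the basis $1,t,t^2,\dots$) are nonnegative.
   Context: A skew shape $\lambda/\mu$ is given by partitions $\lambda=(\lambda_1\ge\cdots\ge\lambda_\ell\ge 0)$ and $\mu=(\mu_1\ge\cdots\ge\mu_\ell\ge 0)$ with $\mu_i\le\lambda_i$ for all $i$; its size is $n=\sum_i(\lambda_i-\mu_i)$. The cell poset $P_{\lambda/\mu}$ has as elements the boxes $\{(i,j): 1\le i\le \ell,\ \mu_i+1\le j\le\lambda_i\}$, with partial order generated by the relations $(i,j)\succeq(i+1,j)$ and $(i,j)\succeq(i,j+1)$ (whenever both boxes belong to the shape). For a finite poset $P$, the order polynomial $\Omega(P;t)$ is the unique polynomial in $\mathbb{Q}[t]$ such that for every positive integer $t$, $\Omega(P;t)$ equals the number of maps $f:P\to\{1,\dots,t\}$ with $f(x)\le f(y)$ whenever $x\preceq y$. For $P=\varnothing$, $\Omega(P;t)=1$. *)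

theory Defs
  imports
    "HOL-Library.FuncSet"
    "HOL-Library.Infinite_Set"
    "HOL-Computational_Algebra.Polynomial"
begin

(* A finite poset is a finite carrier set P with a relation r satisfying partial_order_on P r;
   (x, y) \<in> r stands for x \<preceq> y. The maps P \<rightarrow> {1..t} are the extensional ones, so that there
   is one function for each map on P. *)

definition order_preserving_maps :: "'a set \<Rightarrow> 'a rel \<Rightarrow> nat set \<Rightarrow> ('a \<Rightarrow> nat) set" where
  "order_preserving_maps P r T = {f \<in> P \<rightarrow>\<^sub>E T. \<forall>(x, y) \<in> r. f x \<le> f y}"

definition order_polynomial :: "'a set \<Rightarrow> 'a rel \<Rightarrow> rat poly" where
  "order_polynomial P r =
     (THE p. \<forall>t::nat. t > 0 \<longrightarrow> poly p (of_nat t) = of_nat (card (order_preserving_maps P r {1..t})))"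

(* Partitions are padded with zeros to a common length; the part with 1-based index i is lam ! (i - 1). *)

definition is_partition :: "nat list \<Rightarrow> bool" where
  "is_partition lam \<longleftrightarrow> sorted_wrt (\<ge>) lam"

definition skew_shape :: "nat list \<Rightarrow> nat list \<Rightarrow> bool" where
  "skew_shape lam mu \<longleftrightarrow>
     is_partition lam \<and> is_partition mu \<and> length mu = length lam \<and>
     (\<forall>i < length lam. mu ! i \<le> lam ! i)"

definition skew_size :: "nat list \<Rightarrow> nat list \<Rightarrow> nat" where
  "skew_size lam mu = (\<Sum>i < length lam. lam ! i - mu ! i)"

definition skew_cells :: "nat list \<Rightarrow> nat list \<Rightarrow> (nat \<times> nat) set" where
  "skew_cells lam mu =
     {(i, j). 1 \<le> i \<and> i \<le> length lam \<and> mu ! (i - 1) + 1 \<le> j \<and> j \<le> lam ! (i - 1)}"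

definition cell_steps :: "nat list \<Rightarrow> nat list \<Rightarrow> (nat \<times> nat) rel" where
  "cell_steps lam mu =
     {(x, y). x \<in> skew_cells lam mu \<and> y \<in> skew_cells lam mu \<and>
        (\<exists>i j. y = (i, j) \<and> (x = (i + 1, j) \<or> x = (i, j + 1)))}"

(* The intersection cuts down to the boxes of the shape: the closure operator makes the relation
   reflexive on the whole type. *)

definition cell_order :: "nat list \<Rightarrow> nat list \<Rightarrow> (nat \<times> nat) rel" where
  "cell_order lam mu = (cell_steps lam mu)\<^sup>* \<inter> skew_cells lam mu \<times> skew_cells lam mu"

lemma finite_skew_cells: "finite (skew_cells lam mu)"
proof (rule finite_subset)
  show "skew_cells lam mu \<subseteq> (SIGMA i:{1..length lam}. {1..lam ! (i - 1)})"
    by (auto simp: skew_cells_def)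
qed auto

lemma card_skew_cells: "card (skew_cells lam mu) = skew_size lam mu"
proof -
  have "skew_cells lam mu = (SIGMA i:{1..length lam}. {mu ! (i - 1)<..lam ! (i - 1)})"
    by (auto simp: skew_cells_def)
  then have "card (skew_cells lam mu) = (\<Sum>i\<in>{1..length lam}. lam ! (i - 1) - mu ! (i - 1))"
    by simp
  also have "\<dots> = skew_size lam mu"
    unfolding skew_size_def
    by (rule sum.reindex_bij_witness[where i = Suc and j = "\<lambda>i. i - 1"]) auto
  finally show ?thesis .
qed

lemma partial_order_on_cell_order:
  "partial_order_on (skew_cells lam mu) (cell_order lam mu)"
proof -
  have dec: "x = y \<or> fst x + snd x > fst y + snd y" if "(x, y) \<in> (cell_steps lam mu)\<^sup>*" for x y
    using that
  proof (induction rule: rtrancl_induct)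
    case base
    show ?case by simp
  next
    case (step y z)
    then have "fst y + snd y > fst z + snd z"
      by (auto simp: cell_steps_def)
    with step.IH show ?case by auto
  qed
  have "antisym (cell_order lam mu)"
    by (rule antisymI) (auto simp: cell_order_def dest!: dec)
  moreover have "trans (cell_order lam mu)"
    by (rule transI) (auto simp: cell_order_def)
  ultimately show ?thesis
    by (auto simp: partial_order_on_def preorder_on_def refl_on_def cell_order_def)
qed

lemma order_polynomial_unique:
  fixes p q :: "rat poly"
  assumes "\<And>t::nat. t > 0 \<Longrightarrow> poly p (of_nat t) = poly q (of_nat t)"
  shows "p = q"
proof (rule ccontr)
  assume "p \<noteq> q"
  then have "finite {x. poly (p - q) x = 0}"
    by (intro poly_roots_finite) simp
  moreover have "of_nat ` {1::nat..} \<subseteq> {x. poly (p - q) x = 0}"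
    using assms by auto
  ultimately have "finite ((of_nat :: nat \<Rightarrow> rat) ` {1..})"
    using finite_subset by blast
  then have "finite {1::nat..}"
    by (rule finite_imageD) (simp add: inj_on_def)
  then show False
    by (simp add: infinite_Ici)
qed

lemma card_onto_maps:
  fixes P :: "'a set"
  assumes S: "finite S" and r: "r \<subseteq> P \<times> P"
  shows "card {f \<in> order_preserving_maps P r S. f ` P = S}
       = card {f \<in> order_preserving_maps P r {1..card S}. f ` P = {1..card S}}"
proof -
  obtain h0 where h0: "bij_betw h0 {..<card S} S" "strict_mono_on {..<card S} h0"
    using ex_bij_betw_strict_mono_card[OF S] by blast
  define h where "h = (\<lambda>k. h0 (k - 1))"
  have "bij_betw (\<lambda>k. k - 1) {1..card S} {..<card S}"
    by (rule bij_betw_byWitness[where f' = Suc]) auto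
  then have h1: "bij_betw h {1..card S} S"
    using bij_betw_trans[OF _ h0(1)] by (simp add: h_def comp_def)
  have h2: "strict_mono_on {1..card S} h"
    unfolding h_def by (intro strict_mono_onI strict_mono_onD[OF h0(2)]) auto
  note h = h1 h2
  define g where "g = the_inv_into {1..card S} h"
  have inj: "inj_on h {1..card S}" and im: "h ` {1..card S} = S"
    using h(1) by (auto simp: bij_betw_def)
  have gh: "g (h x) = x" if "x \<in> {1..card S}" for x
    unfolding g_def using inj that by (rule the_inv_into_f_f)
  have hg: "h (g y) = y" "g y \<in> {1..card S}" if "y \<in> S" for y
    using that im gh by force+
  have hm: "h x \<le> h y" if "x \<in> {1..card S}" "y \<in> {1..card S}" "x \<le> y" for x y
    using h(2) that by (metis le_less strict_mono_onD)
  have gm: "g x \<le> g y" if "x \<in> S" "y \<in> S" "x \<le> y" for x y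
    using that hg h(2) by (metis linorder_not_less strict_mono_onD)
  have rP: "x \<in> P" "y \<in> P" if "(x, y) \<in> r" for x y
    using r that by auto
  let ?A = "{f \<in> order_preserving_maps P r S. f ` P = S}"
  let ?B = "{f \<in> order_preserving_maps P r {1..card S}. f ` P = {1..card S}}"
  have A: "f \<in> extensional P" "f ` P = S" "\<And>x. x \<in> P \<Longrightarrow> f x \<in> S"
    "\<And>x y. (x, y) \<in> r \<Longrightarrow> f x \<le> f y" if "f \<in> ?A" for f
    using that by (auto simp: order_preserving_maps_def PiE_def)
  have B: "f \<in> extensional P" "f ` P = {1..card S}" "\<And>x. x \<in> P \<Longrightarrow> f x \<in> {1..card S}"
    "\<And>x y. (x, y) \<in> r \<Longrightarrow> f x \<le> f y" if "f \<in> ?B" for f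
    using that by (auto simp: order_preserving_maps_def PiE_def)
  have "(\<lambda>x. g (h x)) ` {1..card S} = (\<lambda>x. x) ` {1..card S}"
    by (rule image_cong) (simp_all only: gh)
  then have "g ` h ` {1..card S} = {1..card S}"
    by (simp only: image_image image_ident)
  then have gS: "g ` S = {1..card S}"
    by (simp only: im)
  have "bij_betw (\<lambda>f. restrict (g \<circ> f) P) ?A ?B"
  proof (rule bij_betw_byWitness[where f' = "\<lambda>f. restrict (h \<circ> f) P"])
    show "\<forall>f\<in>?A. restrict (h \<circ> restrict (g \<circ> f) P) P = f"
    proof
      fix f assume f: "f \<in> ?A"
      show "restrict (h \<circ> restrict (g \<circ> f) P) P = f"
        by (rule extensionalityI[of _ P]) (use A[OF f] hg in auto)
    qed
    show "\<forall>f\<in>?B. restrict (g \<circ> restrict (h \<circ> f) P) P = f"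
    proof
      fix f assume f: "f \<in> ?B"
      show "restrict (g \<circ> restrict (h \<circ> f) P) P = f"
        by (rule extensionalityI[of _ P]) (use B[OF f] gh in auto)
    qed
    show "(\<lambda>f. restrict (g \<circ> f) P) ` ?A \<subseteq> ?B"
    proof (rule image_subsetI)
      fix f assume f: "f \<in> ?A"
      have "restrict (g \<circ> f) P ` P = {1..card S}"
        by (simp only: image_restrict_eq image_comp[symmetric] A(2)[OF f] gS)
      moreover have "restrict (g \<circ> f) P \<in> P \<rightarrow>\<^sub>E {1..card S}"
        using hg(2)[OF A(3)[OF f]] by (simp only: restrict_PiE_iff comp_apply) blast
      moreover have "\<forall>(x, y) \<in> r. restrict (g \<circ> f) P x \<le> restrict (g \<circ> f) P y"
        using A[OF f] rP gm by auto
      ultimately show "restrict (g \<circ> f) P \<in> ?B"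
        unfolding order_preserving_maps_def by blast
    qed
    show "(\<lambda>f. restrict (h \<circ> f) P) ` ?B \<subseteq> ?A"
    proof (rule image_subsetI)
      fix f assume f: "f \<in> ?B"
      have "restrict (h \<circ> f) P ` P = S"
        by (simp only: image_restrict_eq image_comp[symmetric] B(2)[OF f] im)
      moreover have "restrict (h \<circ> f) P \<in> P \<rightarrow>\<^sub>E S"
        using bij_betwE[OF h1] B(3)[OF f] by (simp only: restrict_PiE_iff comp_apply) blast
      moreover have "\<forall>(x, y) \<in> r. restrict (h \<circ> f) P x \<le> restrict (h \<circ> f) P y"
        using B[OF f] rP hm by auto
      ultimately show "restrict (h \<circ> f) P \<in> ?A"
        unfolding order_preserving_maps_def by blast
    qed
  qed
  then show ?thesis
    by (rule bij_betw_same_card)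
qed

definition binomial_poly :: "nat \<Rightarrow> rat poly" where
  "binomial_poly k = smult (1 / fact k) (\<Prod>i<k. [:- of_nat i, 1:])"

lemma poly_binomial_poly: "poly (binomial_poly k) (of_nat t) = of_nat (t choose k)"
  unfolding binomial_gbinomial gbinomial_prod_rev
  by (simp add: binomial_poly_def poly_prod atLeast0LessThan)

lemma order_polynomial_exists:
  fixes P :: "'a set"
  assumes P: "finite P" and r: "r \<subseteq> P \<times> P"
  shows "\<exists>p::rat poly. \<forall>t::nat. t > 0 \<longrightarrow>
           poly p (of_nat t) = of_nat (card (order_preserving_maps P r {1..t}))"
proof -
  define e where "e k = card {f \<in> order_preserving_maps P r {1..k}. f ` P = {1..k}}" for k
  define p where "p = (\<Sum>k\<le>card P. smult (of_nat (e k)) (binomial_poly k))"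
  have e0: "e k = 0" if "k > card P" for k
  proof -
    have "f ` P \<noteq> {1..k}" for f :: "'a \<Rightarrow> nat"
      using card_image_le[OF P, of f] that by auto
    then show ?thesis by (simp add: e_def)
  qed
  have "poly p (of_nat t) = of_nat (card (order_preserving_maps P r {1..t}))" for t :: nat
  proof -
    let ?F = "\<lambda>S. {f \<in> order_preserving_maps P r S. f ` P = S}"
    have fin: "finite (?F S)" if "S \<subseteq> {1..t}" for S
    proof (rule finite_subset)
      show "?F S \<subseteq> P \<rightarrow>\<^sub>E S"
        by (auto simp: order_preserving_maps_def)
      show "finite (P \<rightarrow>\<^sub>E S)"
        using P that by (intro finite_PiE) (auto intro: finite_subset)
    qed
    have "order_preserving_maps P r {1..t} = (\<Union>S\<in>Pow {1..t}. ?F S)"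
      by (fastforce simp: order_preserving_maps_def PiE_def)
    also have "card \<dots> = (\<Sum>S\<in>Pow {1..t}. card (?F S))"
      by (rule card_UN_disjoint) (use fin in auto)
    also have "\<dots> = (\<Sum>S\<in>Pow {1..t}. e (card S))"
      unfolding e_def using r by (intro sum.cong card_onto_maps) (auto intro: finite_subset)
    also have "\<dots> = (\<Sum>k\<le>t. \<Sum>S\<in>{S \<in> Pow {1..t}. card S = k}. e (card S))"
      using card_mono[of "{1..t}"] by (intro sum.group[symmetric]) auto
    also have "\<dots> = (\<Sum>k\<le>t. (t choose k) * e k)"
      using n_subsets[of "{1..t}"] by (intro sum.cong) auto
    also have "\<dots> = (\<Sum>k\<le>max t (card P). (t choose k) * e k)"
      by (rule sum.mono_neutral_left) auto
    also have "\<dots> = (\<Sum>k\<le>card P. (t choose k) * e k)"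
      by (rule sum.mono_neutral_right) (auto simp: e0)
    finally show ?thesis
      by (simp add: p_def poly_sum poly_binomial_poly mult.commute)
  qed
  then show ?thesis by blast
qed

lemma poly_order_polynomial:
  fixes t :: nat
  assumes "finite P" "partial_order_on P r" "t > 0"
  shows "poly (order_polynomial P r) (of_nat t) = of_nat (card (order_preserving_maps P r {1..t}))"
proof -
  have "r \<subseteq> P \<times> P"
    using assms(2) by (auto simp: partial_order_on_def preorder_on_def refl_on_def)
  then have "\<exists>!p::rat poly. \<forall>t::nat. t > 0 \<longrightarrow>
      poly p (of_nat t) = of_nat (card (order_preserving_maps P r {1..t}))"
    using order_polynomial_exists[OF assms(1)] order_polynomial_unique
    by (metis (no_types, lifting))
  from theI'[OF this] assms(3) show ?thesis
    unfolding order_polynomial_def by blast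
qed

end

theory Submission
  imports Defs Jordan_Normal_Form.Determinant
begin

text \<open>
  For partitions \<open>\<lambda>\<close> and \<open>\<mu>\<close> with \<open>\<ell>\<close> parts let \<open>D(\<lambda>/\<mu>; t)\<close> be the determinant of the
  \<open>\<ell> \<times> \<ell>\<close> matrix with entries \<open>t + \<lambda>\<^sub>i - \<mu>\<^sub>j - 1\<close> choose \<open>\<lambda>\<^sub>i - \<mu>\<^sub>j - i + j\<close>. By a theorem of
  Kreweras it is the order polynomial of the cell poset of \<open>\<lambda>/\<mu>\<close>. The proof of this formula and
  the proof of positivity rest on the same convolution identity
  \<open>D(\<lambda>/\<mu>; s + t) = (\<Sum>\<nu> \<subseteq> \<lambda>. D(\<nu>/\<mu>; s) * D(\<lambda>/\<nu>; t))\<close> (\<open>kreweras_convolution\<close>).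

  The case \<open>t = 1\<close> of the identity says that \<open>D(\<lambda>/\<mu>; s + 1)\<close> is the sum of all \<open>D(\<nu>/\<mu>; s)\<close>. Since
  row \<open>i\<close> depends only on \<open>\<nu>\<^sub>i\<close>, the sum can be done one part at a time: by Pascal's rule the sum of
  row \<open>i\<close> over \<open>\<nu>\<^sub>i\<close> from \<open>\<nu>\<^sub>i\<^sub>+\<^sub>1\<close> to \<open>\<lambda>\<^sub>i\<close> telescopes to the wanted new row minus row \<open>i + 1\<close>, and the
  latter does not change the determinant (\<open>sum_det_telescope\<close>). Iteration gives every positive
  integer \<open>t\<close>, for an arbitrary rational \<open>s\<close>. As \<open>D(\<lambda>/\<mu>; 1) = 1\<close> if \<open>\<mu> \<subseteq> \<lambda>\<close> and \<open>D(\<lambda>/\<mu>; t) = 0\<close>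
  otherwise, the case \<open>s = 1\<close> is the recursion that counts order preserving maps according to the
  region \<open>\<nu>/\<mu>\<close> on which the largest value is taken.

  Differentiating in \<open>s\<close> at \<open>0\<close> gives \<open>D'(\<lambda>/\<mu>; t) = (\<Sum>\<nu> \<subseteq> \<lambda>. L(\<nu>/\<mu>) * D(\<lambda>/\<nu>; t))\<close>, where
  \<open>L(\<nu>/\<mu>)\<close> is the coefficient of \<open>t\<close> in \<open>D(\<nu>/\<mu>; t)\<close>. So if the constant and the linear coefficients
  are nonnegative for all shapes, then so are all coefficients, by induction on the degree of the
  term (\<open>kreweras_poly_coeff_nonneg\<close>).

  For these two coefficients one may assume that consecutive rows of the shape overlap; otherwise
  the matrix is block triangular and the determinant factors. If they overlap, the matrix at \<open>t = 0\<close>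
  is strictly lower triangular with ones just below the diagonal. Hence its first row vanishes,
  \<open>D\<close> has no constant term, and the linear term comes only from the upper right entry, whose
  cofactor at \<open>t = 0\<close> is \<open>(-1)\<^sup>\<ell>\<^sup>-\<^sup>1\<close>. With \<open>m = \<lambda>\<^sub>1 - \<mu>\<^sub>\<ell> - 1\<close> that entry is
  \<open>(t + m) \<cdots> (t + 1) t (t - 1) \<cdots> (t - \<ell> + 1) / (m + \<ell>)!\<close>, whose linear coefficient has the
  same sign, so \<open>L = m! (\<ell> - 1)! / (m + \<ell>)!\<close>.
\<close>

section \<open>Binomial coefficients with an integer lower index\<close>

text \<open>Extending the coefficient by zero to negative lower indices makes Pascal's rule, and hence the
  telescoping below, valid without side conditions.\<close>

definition gchoose_int :: "rat \<Rightarrow> int \<Rightarrow> rat" where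
  "gchoose_int x d = (if d < 0 then 0 else x gchoose nat d)"

lemma gchoose_int_neg [simp]: "d < 0 \<Longrightarrow> gchoose_int x d = 0"
  by (simp add: gchoose_int_def)

lemma gchoose_int_zero [simp]: "gchoose_int x 0 = 1"
  by (simp add: gchoose_int_def)

lemma gchoose_int_pascal: "gchoose_int (x + 1) d = gchoose_int x d + gchoose_int x (d - 1)"
proof (cases "d \<le> 0")
  case True
  then show ?thesis by (cases "d = 0") auto
next
  case False
  then have "nat d = Suc (nat (d - 1))" by linarith
  with False show ?thesis
    by (simp add: gchoose_int_def gbinomial_Suc_Suc)
qed

lemma gchoose_int_of_nat: "gchoose_int (of_nat m) d = (if d < 0 then 0 else of_nat (m choose nat d))"
  by (simp add: gchoose_int_def binomial_gbinomial)

text \<open>Both indices move with the summation variable, as they do in a row of the determinant when the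
  part of that row varies.\<close>

lemma sum_gchoose_int:
  assumes "a \<le> b"
  shows "(\<Sum>x=a..b. gchoose_int (s + of_nat x) (int x + e)) =
         gchoose_int (s + of_nat b + 1) (int b + e) - gchoose_int (s + of_nat a) (int a + e - 1)"
  using assms
proof (induction b rule: dec_induct)
  case base
  show ?case using gchoose_int_pascal[of "s + of_nat a" "int a + e"] by simp
next
  case (step b)
  have "gchoose_int (s + of_nat (Suc b) + 1) (int (Suc b) + e) =
     gchoose_int (s + of_nat (Suc b)) (int (Suc b) + e) + gchoose_int (s + of_nat b + 1) (int b + e)"
    using gchoose_int_pascal[of "s + of_nat (Suc b)" "int (Suc b) + e"] by (simp add: algebra_simps)
  moreover have "(\<Sum>x=a..Suc b. gchoose_int (s + of_nat x) (int x + e)) =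
     gchoose_int (s + of_nat (Suc b)) (int (Suc b) + e) + (\<Sum>x=a..b. gchoose_int (s + of_nat x) (int x + e))"
    using step(1) by (simp add: add.commute)
  ultimately show ?case using step by simp
qed

definition gchoose_int_poly :: "int \<Rightarrow> int \<Rightarrow> rat poly" where
  "gchoose_int_poly m d = (if d < 0 then 0
     else Polynomial.smult (1 / fact (nat d)) (\<Prod>i<nat d. [:of_int (m - int i), 1:]))"

lemma poly_gchoose_int_poly: "poly (gchoose_int_poly m d) s = gchoose_int (s + of_int m) d"
  by (auto simp: gchoose_int_poly_def gchoose_int_def gbinomial_prod_rev poly_prod atLeast0LessThan algebra_simps
      intro!: prod.cong)

lemma poly_det:
  "poly (det A) s = det (map_mat (\<lambda>p. poly p s) A)" for s :: "'a::comm_ring_1"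
proof -
  interpret comm_ring_hom "\<lambda>p. poly p s" by unfold_locales auto
  show ?thesis by simp
qed

section \<open>The Kreweras determinant\<close>

text \<open>The matrix of the introduction with rows and columns numbered from 0. It is defined for all pairs
  of lists, not only for skew shapes, because it is the vanishing of the determinant on the other
  pairs that allows summation over all \<open>\<nu> \<subseteq> \<lambda>\<close>.\<close>

definition kreweras_poly :: "nat list \<Rightarrow> nat list \<Rightarrow> rat poly" where
  "kreweras_poly lam mu = det (mat (length lam) (length lam) (\<lambda>(i, j).
     gchoose_int_poly (int (lam ! i) - int (mu ! j) - 1)
               (int (lam ! i) - int (mu ! j) - int i + int j)))"

lemma poly_kreweras_poly:
  "poly (kreweras_poly lam mu) s = det (mat (length lam) (length lam) (\<lambda>(i, j).
     gchoose_int (s + of_int (int (lam ! i) - int (mu ! j) - 1))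
          (int (lam ! i) - int (mu ! j) - int i + int j)))"
  unfolding kreweras_poly_def poly_det
  by (rule arg_cong[of _ _ det]) (auto simp: poly_gchoose_int_poly intro!: eq_matI)

section \<open>Replacing a row of a determinant\<close>

text \<open>The cofactors along a row do not depend on that row, so the determinant is linear in it.\<close>

lemma det_expand_row:
  fixes b :: "nat \<Rightarrow> 'a::comm_ring_1"
  assumes "k < n"
  shows "det (mat n n (\<lambda>(i, j). if i = k then b j else c i j)) =
         (\<Sum>j<n. b j * cofactor (mat n n (\<lambda>(i, j). c i j)) k j)"
proof -
  let ?A = "mat n n (\<lambda>(i, j). if i = k then b j else c i j)"
  let ?C = "mat n n (\<lambda>(i, j). c i j)"
  have "mat_delete ?A k j = mat_delete ?C k j" for j
    using assms by (auto intro!: eq_matI simp: mat_delete_def)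
  then have "cofactor ?A k j = cofactor ?C k j" for j
    by (simp add: cofactor_def)
  then show ?thesis
    using assms by (simp add: laplace_expansion_row[of ?A n k])
qed

lemma sum_det_row:
  fixes b :: "'b \<Rightarrow> nat \<Rightarrow> 'a::comm_ring_1"
  assumes "k < n"
  shows "(\<Sum>x\<in>S. det (mat n n (\<lambda>(i, j). if i = k then b x j else c i j))) =
         det (mat n n (\<lambda>(i, j). if i = k then (\<Sum>x\<in>S. b x j) else c i j))"
  unfolding det_expand_row[OF assms] sum_distrib_right by (rule sum.swap)

lemma det_subtract_row:
  fixes c :: "nat \<Rightarrow> nat \<Rightarrow> 'a::comm_ring_1"
  assumes "k < n" "l < n" "k \<noteq> l"
  shows "det (mat n n (\<lambda>(i, j). if i = k then b j - c l j else c i j)) =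
         det (mat n n (\<lambda>(i, j). if i = k then b j else c i j))"
proof -
  have "det (mat n n (\<lambda>(i, j). if i = k then c l j else c i j)) = 0"
    by (rule det_identical_rows[of _ n k l]) (use assms in \<open>auto intro!: eq_vecI\<close>)
  then show ?thesis
    unfolding det_expand_row[OF assms(1)] by (simp add: left_diff_distrib sum_subtractf)
qed

section \<open>Partitions inside a given one\<close>

lemma skew_shape_lengthD: "skew_shape lam mu \<Longrightarrow> length mu = length lam"
  by (simp add: skew_shape_def)

lemma is_partition_nth: "is_partition lam \<Longrightarrow> i \<le> j \<Longrightarrow> j < length lam \<Longrightarrow> lam ! j \<le> lam ! i"
  by (cases "i = j") (auto simp: is_partition_def sorted_wrt_iff_nth_less)

lemma skew_shape_Cons_iff:
  assumes "is_partition (x # xs)"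
  shows "skew_shape (x # xs) (y # w) \<longleftrightarrow>
     skew_shape xs w \<and> (if w = [] then 0 else hd w) \<le> y \<and> y \<le> x"
proof -
  have "is_partition (y # w) \<longleftrightarrow> is_partition w \<and> (if w = [] then 0 else hd w) \<le> y"
    by (cases w) (auto simp: is_partition_def)
  moreover have "is_partition xs"
    using assms by (simp add: is_partition_def)
  ultimately show ?thesis
    using assms unfolding skew_shape_def by (simp add: All_less_Suc2) argo
qed

text \<open>The largest part ranges over an interval once the others are chosen; this turns a sum over
  partitions into iterated sums over intervals.\<close>

lemma skew_shapes_Cons:
  assumes "is_partition (x # xs)"
  shows "{nu. skew_shape (x # xs) nu} =
    (\<lambda>(w, y). y # w) ` (SIGMA w:{w. skew_shape xs w}. {(if w = [] then 0 else hd w)..x})"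
proof (intro equalityI subsetI)
  fix nu assume "nu \<in> {nu. skew_shape (x # xs) nu}"
  then have nu: "skew_shape (x # xs) nu" by simp
  then obtain y w where yw: "nu = y # w"
    by (cases nu) (simp_all add: skew_shape_def)
  then show "nu \<in> (\<lambda>(w, y). y # w) ` (SIGMA w:{w. skew_shape xs w}. {(if w = [] then 0 else hd w)..x})"
    using nu unfolding yw skew_shape_Cons_iff[OF assms]
    by (intro image_eqI[of _ _ "(w, y)"]) simp_all
qed (auto simp only: skew_shape_Cons_iff[OF assms] mem_Collect_eq mem_Sigma_iff atLeastAtMost_iff prod.case)

lemma finite_skew_shapes: "finite {nu. skew_shape lam nu}"
proof (rule finite_subset)
  show "{nu. skew_shape lam nu} \<subseteq> {nu. set nu \<subseteq> {..Max (set lam)} \<and> length nu = length lam}"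
  proof clarify
    fix nu assume "skew_shape lam nu"
    then have "length nu = length lam" "\<And>i. i < length lam \<Longrightarrow> nu ! i \<le> lam ! i"
      by (auto simp: skew_shape_def)
    moreover have "\<And>i. i < length lam \<Longrightarrow> lam ! i \<le> Max (set lam)"
      by simp
    ultimately show "set nu \<subseteq> {..Max (set lam)} \<and> length nu = length lam"
      by (auto simp: set_conv_nth intro: order_trans)
  qed
qed (simp add: finite_lists_length_eq)

section \<open>The convolution identity\<close>

text \<open>The parts of \<open>\<nu>\<close> are summed out from the largest to the smallest. At each stage the rows above the
  current one are already the new rows \<open>N\<close>. Summing the current row over its part, whose lower limit
  is the next part, leaves the new row minus the next row, and subtracting another row does not
  affect the determinant. The last row has no successor; there the lower limit is 0 and the correction
  has to be zero.\<close>

lemma sum_det_telescope: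
  fixes R N :: "nat \<Rightarrow> nat \<Rightarrow> nat \<Rightarrow> 'a::comm_ring_1"
  assumes part: "is_partition lam" and n: "length lam = n"
    and step: "\<And>i a b j. Suc i < n \<Longrightarrow> j < n \<Longrightarrow> a \<le> b \<Longrightarrow> (\<Sum>x=a..b. R i x j) = N i b j - R (Suc i) a j"
    and last: "\<And>i b j. Suc i = n \<Longrightarrow> j < n \<Longrightarrow> (\<Sum>x=0..b. R i x j) = N i b j"
  shows "(\<Sum>nu | skew_shape lam nu. det (mat n n (\<lambda>(i, j). R i (nu ! i) j))) =
         det (mat n n (\<lambda>(i, j). N i (lam ! i) j))"
proof -
  define F where "F k v = det (mat n n (\<lambda>(i, j). if i < k then N i (lam ! i) j else R i (v ! (i - k)) j))"
    for k v
  have "(\<Sum>nu | skew_shape (drop k lam) nu. F k nu) = F n []" if "k \<le> n" for k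
    using that
  proof (induction k rule: inc_induct)
    case base
    have "{nu. skew_shape [] nu} = {[]}"
      by (auto simp: skew_shape_def is_partition_def)
    with n show ?case by simp
  next
    case (step k)
    then have k: "k < n" by simp
    have dr: "drop k lam = lam ! k # drop (Suc k) lam"
      using k n by (simp add: Cons_nth_drop_Suc)
    have pd: "is_partition (drop k lam)"
      using part by (simp add: is_partition_def sorted_wrt_drop)
    have row: "(\<Sum>y = (if w = [] then 0 else hd w)..lam ! k. F k (y # w)) = F (Suc k) w"
      if w: "skew_shape (drop (Suc k) lam) w" for w
    proof -
      let ?a = "if w = [] then 0 else hd w"
      define c where "c i j = (if i < k then N i (lam ! i) j else R i (w ! (i - Suc k)) j)" for i j
      have lw: "length w = n - Suc k" using skew_shape_lengthD[OF w] n by simp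
      have "F k (y # w) = det (mat n n (\<lambda>(i, j). if i = k then R k y j else c i j))" for y
        unfolding F_def c_def by (rule arg_cong[of _ _ det]) (auto intro!: eq_matI simp: nth_Cons')
      then have "(\<Sum>y = ?a..lam ! k. F k (y # w)) =
          det (mat n n (\<lambda>(i, j). if i = k then (\<Sum>y = ?a..lam ! k. R k y j) else c i j))"
        by (simp only: sum_det_row[OF k])
      also have "\<dots> = det (mat n n (\<lambda>(i, j). if i = k then N k (lam ! k) j else c i j))"
      proof (cases "Suc k = n")
        case True
        then have "w = []" using lw by simp
        then show ?thesis using last[OF True]
          by (intro arg_cong[of _ _ det]) (auto intro!: eq_matI)
      next
        case False
        then have k1: "Suc k < n" using k by simp
        then have w0: "w \<noteq> []" using lw by auto
        have "hd w = w ! 0" using w0 by (simp add: hd_conv_nth)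
        also have "w ! 0 \<le> lam ! Suc k"
          using w k1 n unfolding skew_shape_def by (auto dest!: spec[of _ 0])
        also have "\<dots> \<le> lam ! k" using is_partition_nth[OF part, of k "Suc k"] k1 n by simp
        finally have le: "hd w \<le> lam ! k" .
        have "(\<Sum>y = ?a..lam ! k. R k y j) = N k (lam ! k) j - c (Suc k) j" if "j < n" for j
          using assms(3)[OF k1 that le] w0 by (simp add: c_def hd_conv_nth)
        then have "det (mat n n (\<lambda>(i, j). if i = k then (\<Sum>y = ?a..lam ! k. R k y j) else c i j)) =
            det (mat n n (\<lambda>(i, j). if i = k then N k (lam ! k) j - c (Suc k) j else c i j))"
          by (intro arg_cong[of _ _ det]) (auto intro!: eq_matI)
        also have "\<dots> = det (mat n n (\<lambda>(i, j). if i = k then N k (lam ! k) j else c i j))"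
          using det_subtract_row[OF k k1] by simp
        finally show ?thesis .
      qed
      also have "\<dots> = F (Suc k) w"
        unfolding F_def c_def by (rule arg_cong[of _ _ det]) (auto intro!: eq_matI)
      finally show ?thesis .
    qed
    have "(\<Sum>nu | skew_shape (drop k lam) nu. F k nu) =
       (\<Sum>(w, y)\<in>(SIGMA w:{w. skew_shape (drop (Suc k) lam) w}. {(if w = [] then 0 else hd w)..lam ! k}). F k (y # w))"
      unfolding dr skew_shapes_Cons[OF pd[unfolded dr]]
      by (subst sum.reindex) (auto simp: inj_on_def case_prod_unfold)
    also have "\<dots> = (\<Sum>w | skew_shape (drop (Suc k) lam) w. F (Suc k) w)"
      by (subst sum.Sigma[symmetric]) (auto simp: finite_skew_shapes row simp del: drop_Suc)
    finally show ?case using step by simp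
  qed
  from this[of 0] have "(\<Sum>nu | skew_shape lam nu. F 0 nu) = F n []"
    by simp
  moreover have "F n [] = det (mat n n (\<lambda>(i, j). N i (lam ! i) j))"
    unfolding F_def by (rule arg_cong[of _ _ det]) (auto intro!: eq_matI)
  ultimately show ?thesis
    by (simp add: F_def)
qed

lemma sum_kreweras:
  assumes part: "is_partition lam"
  shows "(\<Sum>nu | skew_shape lam nu. poly (kreweras_poly nu mu) s) =
         poly (kreweras_poly lam mu) (s + 1)"
proof -
  define n where "n = length lam"
  define R where "R i x j = gchoose_int (s + of_int (int x - int (mu ! j) - 1)) (int x - int (mu ! j) - int i + int j)"
    for i x j
  define N where "N i x j = gchoose_int (s + 1 + of_int (int x - int (mu ! j) - 1)) (int x - int (mu ! j) - int i + int j)"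
    for i x j
  have tel: "(\<Sum>x=a..b. R i x j) = N i b j - R (Suc i) a j" if "a \<le> b" for i j a b
    using sum_gchoose_int[OF that, of "s - of_nat (mu ! j) - 1" "int j - int i - int (mu ! j)"]
    by (simp add: R_def N_def algebra_simps)
  have "(\<Sum>nu | skew_shape lam nu. poly (kreweras_poly nu mu) s) =
        (\<Sum>nu | skew_shape lam nu. det (mat n n (\<lambda>(i, j). R i (nu ! i) j)))"
    by (intro sum.cong) (auto simp: poly_kreweras_poly R_def n_def dest: skew_shape_lengthD)
  also have "\<dots> = det (mat n n (\<lambda>(i, j). N i (lam ! i) j))"
  proof (rule sum_det_telescope[OF part n_def[symmetric]])
    show "(\<Sum>x=0..b. R i x j) = N i b j" if "Suc i = n" "j < n" for i b j
    proof -
      \<comment> \<open>a row below the last one: its lower index at part 0 is at most \<open>j - n\<close>, which is negative\<close>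
      have "R (Suc i) 0 j = 0" using that by (simp add: R_def)
      then show ?thesis using tel[of 0 b i j] by simp
    qed
  qed (rule tel)
  also have "\<dots> = poly (kreweras_poly lam mu) (s + 1)"
    by (simp add: poly_kreweras_poly N_def n_def)
  finally show ?thesis .
qed

text \<open>The zero block has \<open>n - k\<close> rows and \<open>k + 1\<close> columns, together more than \<open>n\<close>, so by the pigeonhole
  principle every permutation meets it.\<close>

lemma det_zero_block:
  fixes A :: "'a::comm_ring_1 mat"
  assumes A: "A \<in> carrier_mat n n" and k: "k < n"
    and zero: "\<And>i j. k \<le> i \<Longrightarrow> i < n \<Longrightarrow> j \<le> k \<Longrightarrow> A $$ (i, j) = 0"
  shows "det A = 0"
proof -
  have "(\<Prod>i = 0..<n. A $$ (i, p i)) = 0" if p: "p permutes {0..<n}" for p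
  proof -
    have "\<exists>i\<in>{k..<n}. p i \<le> k"
    proof (rule ccontr)
      assume "\<not> ?thesis"
      then have "p ` {k..<n} \<subseteq> {Suc k..<n}"
        using permutes_in_image[OF p] by (auto simp: not_le Suc_le_eq)
      then have "card (p ` {k..<n}) \<le> n - Suc k"
        using card_mono[of "{Suc k..<n}"] by simp
      moreover have "card (p ` {k..<n}) = n - k"
        using permutes_inj_on[OF p, of "{k..<n}"] by (simp add: card_image)
      ultimately show False using k by linarith
    qed
    then obtain i where "i \<in> {k..<n}" "p i \<le> k" by blast
    then have "i \<in> {0..<n}" "A $$ (i, p i) = 0" using zero by simp_all
    then show ?thesis by (metis finite_atLeastLessThan prod_zero)
  qed
  then show ?thesis
    unfolding det_def'[OF A] by simp
qed

text \<open>If part \<open>k\<close> of \<open>\<mu>\<close> exceeds that of \<open>\<lambda>\<close>, the lower indices are negative in all rows from \<open>k\<close> on and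
  all columns up to \<open>k\<close>.\<close>

lemma kreweras_poly_eq_0:
  assumes lam: "is_partition lam" and mu: "is_partition mu" and len: "length mu = length lam"
    and not: "\<not> skew_shape lam mu"
  shows "kreweras_poly lam mu = 0"
proof -
  obtain k where k: "k < length lam" "lam ! k < mu ! k"
    using assms by (auto simp: skew_shape_def not_le)
  show ?thesis
    unfolding kreweras_poly_def
  proof (rule det_zero_block[OF _ k(1)])
    fix i j assume ij: "k \<le> i" "i < length lam" "j \<le> k"
    then have "lam ! i \<le> lam ! k" "mu ! k \<le> mu ! j"
      using is_partition_nth[OF lam] is_partition_nth[OF mu] k len by auto
    with k ij show "mat (length lam) (length lam) (\<lambda>(i, j). gchoose_int_poly (int (lam ! i) - int (mu ! j) - 1)
      (int (lam ! i) - int (mu ! j) - int i + int j)) $$ (i, j) = 0"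
      by (simp add: gchoose_int_poly_def)
  qed simp
qed

text \<open>At \<open>t = 1\<close> and on or above the diagonal, the upper index is \<open>\<lambda>\<^sub>i - \<mu>\<^sub>j\<close>, which is nonnegative, and the lower
  index is larger by \<open>j - i\<close>; so the matrix is unitriangular.\<close>

lemma kreweras_poly_1:
  assumes "skew_shape lam mu"
  shows "poly (kreweras_poly lam mu) 1 = 1"
proof -
  define A where "A = mat (length lam) (length lam) (\<lambda>(i, j).
     gchoose_int (1 + of_int (int (lam ! i) - int (mu ! j) - 1))
          (int (lam ! i) - int (mu ! j) - int i + int j))"
  have mu: "is_partition mu" and len: "length mu = length lam"
    and le: "\<forall>i < length lam. mu ! i \<le> lam ! i"
    using assms by (simp_all add: skew_shape_def)
  have A: "A $$ (i, j) = (if i = j then 1 else 0)"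
    if "i \<le> j" "j < length lam" for i j
  proof -
    have "mu ! j \<le> mu ! i" "mu ! i \<le> lam ! i"
      using that is_partition_nth[OF mu, of i j] le len by simp_all
    then obtain m where m: "lam ! i = mu ! j + m"
      using le_trans le_Suc_ex by blast
    have "A $$ (i, j) = gchoose_int (of_nat m) (int (m + (j - i)))"
      using that by (simp add: A_def m of_nat_diff algebra_simps)
    also have "\<dots> = of_nat (m choose (m + (j - i)))"
      by (simp only: gchoose_int_of_nat of_nat_less_0_iff if_False nat_int)
    also have "\<dots> = (if i = j then 1 else 0)"
      using that by auto
    finally show ?thesis .
  qed
  have "det A = prod_list (diag_mat A)"
    by (rule det_lower_triangular[where n = "length lam"]) (simp_all add: A, simp add: A_def)
  also have "\<dots> = (\<Prod>i = 0..<length lam. A $$ (i, i))"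
    by (simp add: prod_list_diag_prod A_def)
  also have "\<dots> = 1"
    by (simp add: A)
  finally show ?thesis
    by (simp only: poly_kreweras_poly A_def)
qed

lemma skew_shape_trans:
  assumes "skew_shape lam nu" "skew_shape nu mu"
  shows "skew_shape lam mu"
  using assms by (auto simp: skew_shape_def intro: le_trans)

text \<open>Induction on \<open>t\<close>: the step is one application of the summation formula on each side.\<close>

lemma kreweras_convolution:
  assumes lam: "is_partition lam" and mu: "is_partition mu" and len: "length mu = length lam" and t: "t > 0"
  shows "poly (kreweras_poly lam mu) (s + of_nat t) =
    (\<Sum>nu | skew_shape lam nu. poly (kreweras_poly nu mu) s * poly (kreweras_poly lam nu) (of_nat t))"
  using t lam len
proof (induction t arbitrary: lam rule: nat_induct_non_zero)
  case 1
  then show ?case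
    using sum_kreweras[of lam mu s] by (simp add: kreweras_poly_1)
next
  case (Suc t)
  let ?D = "\<lambda>lam mu. poly (kreweras_poly lam mu)"
  have "?D lam mu (s + of_nat (Suc t)) = (\<Sum>kap | skew_shape lam kap. ?D kap mu (s + of_nat t))"
    using sum_kreweras[OF Suc.prems(1), of mu "s + of_nat t"] by (simp add: algebra_simps)
  also have "\<dots> = (\<Sum>kap | skew_shape lam kap. \<Sum>nu | skew_shape kap nu. ?D nu mu s * ?D kap nu (of_nat t))"
  proof (rule sum.cong[OF refl])
    fix kap assume "kap \<in> {kap. skew_shape lam kap}"
    then have "is_partition kap" "length mu = length kap"
      using Suc.prems by (simp_all add: skew_shape_def)
    then show "?D kap mu (s + of_nat t) = (\<Sum>nu | skew_shape kap nu. ?D nu mu s * ?D kap nu (of_nat t))"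
      by (rule Suc.IH)
  qed
  also have "\<dots> = (\<Sum>kap | skew_shape lam kap. \<Sum>nu | skew_shape lam nu. ?D nu mu s * ?D kap nu (of_nat t))"
  proof (rule sum.cong[OF refl])
    fix kap assume "kap \<in> {kap. skew_shape lam kap}"
    then have kap: "skew_shape lam kap" by simp
    show "(\<Sum>nu | skew_shape kap nu. ?D nu mu s * ?D kap nu (of_nat t)) =
          (\<Sum>nu | skew_shape lam nu. ?D nu mu s * ?D kap nu (of_nat t))"
    proof (rule sum.mono_neutral_left)
      show "\<forall>nu\<in>{nu. skew_shape lam nu} - {nu. skew_shape kap nu}.
          ?D nu mu s * ?D kap nu (of_nat t) = 0"
        using kap by (auto simp: kreweras_poly_eq_0 skew_shape_def)
    qed (use kap skew_shape_trans finite_skew_shapes in auto)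
  qed
  also have "\<dots> = (\<Sum>nu | skew_shape lam nu. \<Sum>kap | skew_shape lam kap. ?D nu mu s * ?D kap nu (of_nat t))"
    by (rule sum.swap)
  also have "\<dots> = (\<Sum>nu | skew_shape lam nu. ?D nu mu s * ?D lam nu (of_nat (Suc t)))"
    using sum_kreweras[OF Suc.prems(1), of _ "of_nat t"]
    by (simp add: sum_distrib_left[symmetric] add.commute)
  finally show ?case .
qed

section \<open>All coefficients are determined by the linear ones\<close>

text \<open>The convolution identity holds for all rational \<open>s\<close>, so for fixed \<open>t\<close> it is an identity of polynomials
  in \<open>s\<close>; the claim compares the coefficients of \<open>s\<close>. It is enough to do so for positive integers \<open>t\<close>.\<close>

lemma pderiv_kreweras_poly:
  assumes lam: "is_partition lam" and mu: "is_partition mu" and len: "length mu = length lam"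
  shows "pderiv (kreweras_poly lam mu) =
    (\<Sum>nu | skew_shape lam nu. Polynomial.smult (coeff (kreweras_poly nu mu) 1) (kreweras_poly lam nu))"
proof (rule order_polynomial_unique)
  fix t :: nat assume t: "t > 0"
  define r where "r nu = poly (kreweras_poly lam nu) (of_nat t)" for nu
  have "pcompose (kreweras_poly lam mu) [:of_nat t, 1:] =
        (\<Sum>nu | skew_shape lam nu. Polynomial.smult (r nu) (kreweras_poly nu mu))" (is "?L = ?R")
  proof (rule poly_ext)
    fix s :: rat
    show "poly ?L s = poly ?R s"
      using kreweras_convolution[OF lam mu len t, of s]
      by (simp add: poly_pcompose poly_sum r_def mult.commute add.commute)
  qed
  then have "coeff ?L 1 = coeff ?R 1" by simp
  moreover have "coeff ?L 1 = poly (pderiv ?L) 0"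
    by (simp add: poly_0_coeff_0 coeff_pderiv)
  ultimately have "poly (pderiv (kreweras_poly lam mu)) (of_nat t) =
      (\<Sum>nu | skew_shape lam nu. r nu * coeff (kreweras_poly nu mu) 1)"
    by (simp add: pderiv_pcompose poly_pcompose pderiv_pCons coeff_sum)
  then show "poly (pderiv (kreweras_poly lam mu)) (of_nat t) =
    poly (\<Sum>nu | skew_shape lam nu. Polynomial.smult (coeff (kreweras_poly nu mu) 1) (kreweras_poly lam nu)) (of_nat t)"
    by (simp add: poly_sum r_def mult.commute)
qed

section \<open>The constant and linear coefficients\<close>

text \<open>Up to a positive factor the polynomial is \<open>(t + m) \<cdots> (t + 1) t (t - 1) \<cdots> (t - k)\<close>. Without the
  factor \<open>t\<close>, its value at 0 is \<open>m!\<close> times \<open>k\<close> negative numbers.\<close>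

lemma coeff_1_gchoose_int_poly:
  "(-1) ^ k * coeff (gchoose_int_poly (int m) (int m + int k + 1)) 1 \<ge> 0"
proof -
  define f where "f i = [:rat_of_int (int m - int i), 1:]" for i
  have split: "(\<Prod>i<a + b. f i) = (\<Prod>i<a. f i) * (\<Prod>i<b. f (a + i))" for a b
    by (induction b) (simp_all add: mult_ac)
  define q where "q = (\<Prod>i<m. f i) * (\<Prod>i<k. f (Suc m + i))"
  \<comment> \<open>the factor \<open>f m\<close> is the variable itself\<close>
  have "(\<Prod>i<Suc m + k. f i) = q * f m"
    unfolding split[of "Suc m" k] q_def by (simp add: mult_ac)
  also have "\<dots> = pCons 0 q"
    by (simp add: f_def)
  finally have "gchoose_int_poly (int m) (int m + int k + 1) = Polynomial.smult (1 / fact (Suc m + k)) (pCons 0 q)"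
    by (simp add: gchoose_int_poly_def f_def nat_add_distrib)
  then have "(-1) ^ k * coeff (gchoose_int_poly (int m) (int m + int k + 1)) 1 =
      ((-1) ^ k * poly q 0) / fact (Suc m + k)"
    by (simp add: poly_0_coeff_0)
  also have "(-1) ^ k * poly q 0 = (\<Prod>i<m. of_int (int m - int i)) * (\<Prod>i<k. of_nat (Suc i))"
  proof -
    have "poly q 0 = (\<Prod>i<m. of_int (int m - int i)) * (\<Prod>i<k. - of_nat (Suc i))"
      by (simp add: q_def f_def poly_prod)
    moreover have "(\<Prod>i<k. - rat_of_nat (Suc i)) = (-1) ^ k * (\<Prod>i<k. of_nat (Suc i))"
      by (induction k) (simp_all add: algebra_simps)
    ultimately show ?thesis
      by (simp add: power_mult_distrib[symmetric] flip: mult.assoc)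
  qed
  also have "\<dots> / fact (Suc m + k) \<ge> 0"
    by (intro divide_nonneg_nonneg mult_nonneg_nonneg prod_nonneg) auto
  finally show ?thesis .
qed

lemma coeff_mult_Suc_0:
  "coeff (p * q) (Suc 0) = coeff p 0 * coeff q (Suc 0) + coeff p (Suc 0) * coeff q 0"
  by (simp add: coeff_mult)

text \<open>At \<open>t = 0\<close> the matrix is strictly lower triangular with ones below the diagonal. In the Laplace
  expansion along the first row each entry is divisible by \<open>t\<close>, so only the values of the cofactors at
  \<open>0\<close> matter. The minor of column \<open>j\<close> is again lower triangular; its diagonal has ones from below the
  diagonal of the matrix in front of column \<open>j\<close> and zeros from the diagonal itself after it, so only
  the last column contributes.\<close>

lemma kreweras_poly_connected:
  assumes mu: "is_partition mu" and len: "length mu = length lam" and n: "length lam > 0"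
    and row: "\<And>i. i < length lam \<Longrightarrow> mu ! i < lam ! i"
    and next_row: "\<And>i. Suc i < length lam \<Longrightarrow> mu ! i < lam ! Suc i"
  shows "coeff (kreweras_poly lam mu) 0 = 0" "coeff (kreweras_poly lam mu) 1 \<ge> 0"
proof -
  define n where "n = length lam"
  define e where "e i j = gchoose_int_poly (int (lam ! i) - int (mu ! j) - 1)
    (int (lam ! i) - int (mu ! j) - int i + int j)" for i j
  define A where "A = mat n n (\<lambda>(i, j). e i j)"
  have A: "A \<in> carrier_mat n n" by (simp add: A_def)
  have n0: "0 < n" using n by (simp add: n_def)
  have upper: "poly (e i j) 0 = 0" if "i \<le> j" "j < n" for i j
  proof -
    have "mu ! j \<le> mu ! i" "mu ! i < lam ! i"
      using that is_partition_nth[OF mu, of i j] row len by (simp_all add: n_def)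
    then have "mu ! j < lam ! i" by simp
    \<comment> \<open>\<open>m\<close> is the upper index at \<open>t = 0\<close>; the lower index is larger\<close>
    from less_imp_Suc_add[OF this] obtain m where m: "lam ! i = Suc (mu ! j + m)" ..
    have "poly (e i j) 0 = gchoose_int (of_nat m) (int (Suc m + (j - i)))"
      using that by (simp add: e_def m poly_gchoose_int_poly of_nat_diff algebra_simps)
    also have "\<dots> = of_nat (m choose (Suc m + (j - i)))"
      by (simp only: gchoose_int_of_nat of_nat_less_0_iff if_False nat_int)
    also have "m choose (Suc m + (j - i)) = 0"
      by (rule binomial_eq_0) simp
    finally show ?thesis by simp
  qed
  have sub: "poly (e (Suc i) i) 0 = 1" if "Suc i < n" for i
  proof -
    have "mu ! i < lam ! Suc i"
      using next_row that by (simp add: n_def)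
    from less_imp_Suc_add[OF this] obtain m where m: "lam ! Suc i = Suc (mu ! i + m)" ..
    have "poly (e (Suc i) i) 0 = gchoose_int (of_nat m) (int m)"
      by (simp add: e_def m poly_gchoose_int_poly)
    then show ?thesis by (simp add: gchoose_int_of_nat)
  qed
  have minor: "poly (cofactor A 0 j) 0 = (if j = n - 1 then (-1) ^ (n - 1) else 0)" if j: "j < n" for j
  proof -
    define B where "B = map_mat (\<lambda>p. poly p 0) (mat_delete A 0 j)"
    have B: "B $$ (i, k) = poly (e (Suc i) (if k < j then k else Suc k)) 0" if "i < n - 1" "k < n - 1" for i k
      using that j by (auto simp: B_def A_def mat_delete_def)
    have dim: "B \<in> carrier_mat (n - 1) (n - 1)"
      by (simp add: B_def A_def mat_delete_def)
    have "det B = prod_list (diag_mat B)"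
      by (rule det_lower_triangular[OF _ dim]) (auto simp: B upper)
    also have "\<dots> = (\<Prod>i = 0..<n - 1. B $$ (i, i))"
      using dim by (simp add: prod_list_diag_prod)
    also have "\<dots> = (\<Prod>i = 0..<n - 1. if i < j then 1 else 0)"
      by (intro prod.cong) (auto simp: B upper sub)
    also have "\<dots> = (if j = n - 1 then 1 else 0)"
    proof (cases "j = n - 1")
      case False
      with j have "j \<in> {0..<n - 1}" by simp
      then show ?thesis using False by (auto intro!: prod_zero)
    qed simp
    finally show ?thesis
      by (auto simp: cofactor_def poly_det B_def)
  qed
  have D: "kreweras_poly lam mu = (\<Sum>j<n. e 0 j * cofactor A 0 j)"
    using laplace_expansion_row[OF A n0] n0
    by (simp add: kreweras_poly_def n_def A_def e_def)
  have e0: "coeff (e 0 j) 0 = 0" if "j < n" for j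
    using upper[of 0 j] that by (simp add: poly_0_coeff_0)
  show "coeff (kreweras_poly lam mu) 0 = 0"
    by (simp add: D coeff_sum coeff_mult_0 e0)
  have "coeff (kreweras_poly lam mu) 1 = (\<Sum>j<n. coeff (e 0 j) 1 * poly (cofactor A 0 j) 0)"
    by (simp add: D coeff_sum coeff_mult_Suc_0 e0 poly_0_coeff_0)
  also have "\<dots> = (\<Sum>j<n. if j = n - 1 then (-1) ^ (n - 1) * coeff (e 0 (n - 1)) 1 else 0)"
    by (intro sum.cong) (auto simp: minor)
  also have "\<dots> = (-1) ^ (n - 1) * coeff (e 0 (n - 1)) 1"
    using n0 by simp
  also have "\<dots> \<ge> 0"
  proof -
    have "mu ! (n - 1) < lam ! 0"
      using is_partition_nth[OF mu, of 0 "n - 1"] row[of 0] n0 len by (simp add: n_def)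
    from less_imp_Suc_add[OF this] obtain m where m: "lam ! 0 = Suc (mu ! (n - 1) + m)" ..
    have "e 0 (n - 1) = gchoose_int_poly (int m) (int m + int (n - 1) + 1)"
      by (simp add: e_def m algebra_simps)
    then show ?thesis using coeff_1_gchoose_int_poly by simp
  qed
  finally show "coeff (kreweras_poly lam mu) 1 \<ge> 0" .
qed

text \<open>If rows \<open>i\<close> and \<open>i + 1\<close> have no column in common, all lower indices in the block below row \<open>i\<close> and
  left of column \<open>i + 1\<close> are negative.\<close>

lemma kreweras_poly_disconnected:
  assumes lam: "is_partition lam" and mu: "is_partition mu" and len: "length mu = length lam"
    and i: "Suc i < length lam" and gap: "lam ! Suc i \<le> mu ! i"
  shows "kreweras_poly lam mu =
    kreweras_poly (take (Suc i) lam) (take (Suc i) mu) * kreweras_poly (drop (Suc i) lam) (drop (Suc i) mu)"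
proof -
  define k n where "k = Suc i" and "n = length lam"
  define e where "e i j = gchoose_int_poly (int (lam ! i) - int (mu ! j) - 1)
    (int (lam ! i) - int (mu ! j) - int i + int j)" for i j
  define A1 where "A1 = mat k k (\<lambda>(i, j). e i j)"
  define A2 where "A2 = mat k (n - k) (\<lambda>(i, j). e i (k + j))"
  define A4 where "A4 = mat (n - k) (n - k) (\<lambda>(i, j). e (k + i) (k + j))"
  have kn: "k < n" using i by (simp add: k_def n_def)
  have low: "e a b = 0" if "k \<le> a" "a < n" "b < k" for a b
  proof -
    have "lam ! a \<le> lam ! k" "mu ! i \<le> mu ! b"
      using that kn len is_partition_nth[OF lam, of k a] is_partition_nth[OF mu, of b i]
      by (simp_all add: k_def n_def)
    with gap have "lam ! a \<le> mu ! b" by (simp add: k_def)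
    with that show ?thesis by (simp add: e_def gchoose_int_poly_def)
  qed
  have "mat n n (\<lambda>(i, j). e i j) = four_block_mat A1 A2 (0\<^sub>m (n - k) k) A4"
    by (rule eq_matI) (use kn low in \<open>auto simp: A1_def A2_def A4_def\<close>)
  then have "kreweras_poly lam mu = det (four_block_mat A1 A2 (0\<^sub>m (n - k) k) A4)"
    by (simp add: kreweras_poly_def n_def e_def)
  also have "\<dots> = det A1 * det A4"
    by (rule det_four_block_mat_lower_left_zero[of _ k _ "n - k"]) (simp_all add: A1_def A2_def A4_def)
  also have "det A1 = kreweras_poly (take k lam) (take k mu)"
    unfolding kreweras_poly_def A1_def
    by (rule arg_cong[of _ _ det]) (use kn in \<open>auto intro!: eq_matI simp: e_def n_def algebra_simps\<close>)
  also have "det A4 = kreweras_poly (drop k lam) (drop k mu)"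
    unfolding kreweras_poly_def A4_def
    by (rule arg_cong[of _ _ det]) (use kn len in \<open>auto intro!: eq_matI simp: e_def n_def algebra_simps\<close>)
  finally show ?thesis by (simp add: k_def)
qed

text \<open>Besides gaps and connected shapes only the list without parts and a single row without cells
  remain: an empty row in a longer list without gap is impossible, because it would have to overlap
  a neighbour.\<close>

lemma kreweras_poly_low_coeffs_nonneg:
  assumes "skew_shape lam mu"
  shows "coeff (kreweras_poly lam mu) 0 \<ge> 0 \<and> coeff (kreweras_poly lam mu) 1 \<ge> 0"
  using assms
proof (induction "length lam" arbitrary: lam mu rule: less_induct)
  case less
  then have lam: "is_partition lam" and mu: "is_partition mu" and len: "length mu = length lam"
    and le: "\<And>i. i < length lam \<Longrightarrow> mu ! i \<le> lam ! i"
    by (simp_all add: skew_shape_def)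
  consider (empty) "length lam = 0"
    | (gap) i where "Suc i < length lam" "lam ! Suc i \<le> mu ! i"
    | (no_cells) "length lam = 1" "lam ! 0 = mu ! 0"
    | (connected) "length lam > 0" "\<And>i. i < length lam \<Longrightarrow> mu ! i < lam ! i"
        "\<And>i. Suc i < length lam \<Longrightarrow> mu ! i < lam ! Suc i"
  proof (cases "length lam = 0 \<or> (\<exists>i. Suc i < length lam \<and> lam ! Suc i \<le> mu ! i)")
    case True
    then show ?thesis using empty gap by blast
  next
    case False
    then have n: "length lam > 0" and next_row: "\<And>i. Suc i < length lam \<Longrightarrow> mu ! i < lam ! Suc i"
      by (auto simp: not_le)
    show ?thesis
    proof (cases "length lam = 1 \<and> lam ! 0 = mu ! 0")
      case True
      then show ?thesis using no_cells by blast
    next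
      case many: False
      have "mu ! i < lam ! i" if i: "i < length lam" for i
      proof (cases "Suc i < length lam")
        case True
        then show ?thesis
          using next_row[OF True] is_partition_nth[OF lam, of i "Suc i"] by simp
      next
        case last: False
        show ?thesis
        proof (cases i)
          case 0
          then show ?thesis using many last le[OF i] i by (cases "length lam = 1") auto
        next
          case (Suc j)
          then show ?thesis
            using next_row[of j] is_partition_nth[OF mu, of j i] i len by simp
        qed
      qed
      then show ?thesis using connected n next_row by blast
    qed
  qed
  then show ?case
  proof cases
    case empty
    then show ?thesis by (simp add: kreweras_poly_def)
  next
    case gap
    have "skew_shape (take (Suc i) lam) (take (Suc i) mu)" "skew_shape (drop (Suc i) lam) (drop (Suc i) mu)"
      using lam mu len le by (auto simp: skew_shape_def is_partition_def sorted_wrt_take sorted_wrt_drop)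
    then have "coeff (kreweras_poly (take (Suc i) lam) (take (Suc i) mu)) 0 \<ge> 0 \<and>
        coeff (kreweras_poly (take (Suc i) lam) (take (Suc i) mu)) 1 \<ge> 0"
      "coeff (kreweras_poly (drop (Suc i) lam) (drop (Suc i) mu)) 0 \<ge> 0 \<and>
        coeff (kreweras_poly (drop (Suc i) lam) (drop (Suc i) mu)) 1 \<ge> 0"
      using less.hyps gap(1) by simp_all
    then show ?thesis
      unfolding kreweras_poly_disconnected[OF lam mu len gap] by (simp add: coeff_mult_0 coeff_mult_Suc_0)
  next
    case no_cells
    then have "kreweras_poly lam mu = 1"
      by (simp add: kreweras_poly_def det_single gchoose_int_poly_def)
    then show ?thesis by simp
  next
    case connected
    then show ?thesis
      using kreweras_poly_connected[OF mu len] by simp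
  qed
qed

section \<open>Nonnegativity of all coefficients\<close>

lemma kreweras_poly_coeff_nonneg:
  assumes "skew_shape lam mu"
  shows "coeff (kreweras_poly lam mu) k \<ge> 0"
  using assms
proof (induction k arbitrary: lam mu)
  case 0
  then show ?case using kreweras_poly_low_coeffs_nonneg by blast
next
  case (Suc k)
  then have lam: "is_partition lam" and mu: "is_partition mu" and len: "length mu = length lam"
    by (simp_all add: skew_shape_def)
  have "of_nat (Suc k) * coeff (kreweras_poly lam mu) (Suc k) = coeff (pderiv (kreweras_poly lam mu)) k"
    by (simp only: coeff_pderiv)
  also have "\<dots> = (\<Sum>nu | skew_shape lam nu. coeff (kreweras_poly nu mu) 1 * coeff (kreweras_poly lam nu) k)"
    by (simp add: pderiv_kreweras_poly[OF lam mu len] coeff_sum)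
  also have "\<dots> \<ge> 0"
  proof (intro sum_nonneg mult_nonneg_nonneg)
    fix nu assume "nu \<in> {nu. skew_shape lam nu}"
    then have nu: "skew_shape lam nu" by simp
    then show "coeff (kreweras_poly lam nu) k \<ge> 0" by (rule Suc.IH)
    have "is_partition nu" "length mu = length nu"
      using nu len by (simp_all add: skew_shape_def)
    then show "coeff (kreweras_poly nu mu) 1 \<ge> 0"
      using kreweras_poly_low_coeffs_nonneg[of nu mu] kreweras_poly_eq_0[of nu mu] mu
      by (cases "skew_shape nu mu") simp_all
  qed
  finally show ?case
    by (simp add: zero_le_mult_iff)
qed

section \<open>Counting order preserving maps of a skew shape\<close>

lemma order_preserving_maps_cells_iff:
  "f \<in> order_preserving_maps (skew_cells lam mu) (cell_order lam mu) T \<longleftrightarrow>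
    f \<in> skew_cells lam mu \<rightarrow>\<^sub>E T \<and>
    (\<forall>i j. (i, j) \<in> skew_cells lam mu \<longrightarrow>
       ((Suc i, j) \<in> skew_cells lam mu \<longrightarrow> f (Suc i, j) \<le> f (i, j)) \<and>
       ((i, Suc j) \<in> skew_cells lam mu \<longrightarrow> f (i, Suc j) \<le> f (i, j)))" (is "_ \<longleftrightarrow> _ \<and> ?mono")
proof -
  have "?mono \<longleftrightarrow> (\<forall>(x, y) \<in> cell_steps lam mu. f x \<le> f y)"
    by (fastforce simp: cell_steps_def)
  also have "\<dots> \<longleftrightarrow> (\<forall>(x, y) \<in> cell_order lam mu. f x \<le> f y)"
  proof
    assume steps: "\<forall>(x, y) \<in> cell_steps lam mu. f x \<le> f y"
    have "f x \<le> f y" if "(x, y) \<in> (cell_steps lam mu)\<^sup>*" for x y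
      using that
    proof (induction rule: rtrancl_induct)
      case (step y z)
      then show ?case using steps by fastforce
    qed simp
    then show "\<forall>(x, y) \<in> cell_order lam mu. f x \<le> f y"
      by (auto simp: cell_order_def)
  next
    assume "\<forall>(x, y) \<in> cell_order lam mu. f x \<le> f y"
    moreover have "cell_steps lam mu \<subseteq> cell_order lam mu"
      by (auto simp: cell_order_def cell_steps_def)
    ultimately show "\<forall>(x, y) \<in> cell_steps lam mu. f x \<le> f y" by blast
  qed
  finally show ?thesis
    by (simp add: order_preserving_maps_def)
qed

lemma skew_cells_Suc_iff:
  "(Suc i, j) \<in> skew_cells lam mu \<longleftrightarrow> i < length lam \<and> mu ! i < j \<and> j \<le> lam ! i"
  by (auto simp: skew_cells_def)

lemma skew_cells_0 [simp]: "(0, j) \<notin> skew_cells lam mu"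
  by (simp add: skew_cells_def)

lemma skew_cellsE:
  assumes "x \<in> skew_cells lam mu"
  obtains i j where "x = (Suc i, j)"
proof -
  obtain a b where x: "x = (a, b)" by (cases x)
  with assms have "a \<noteq> 0" by (cases a) simp_all
  then show ?thesis using that x not0_implies_Suc by blast
qed

lemma skew_cells_split:
  assumes "skew_shape lam nu" "skew_shape nu mu"
  shows "skew_cells lam mu = skew_cells lam nu \<union> skew_cells nu mu"
    and "skew_cells lam nu \<inter> skew_cells nu mu = {}"
proof -
  have len: "length nu = length lam" and le: "\<And>i. i < length lam \<Longrightarrow> mu ! i \<le> nu ! i \<and> nu ! i \<le> lam ! i"
    using assms by (simp_all add: skew_shape_def)
  have "(i, j) \<in> skew_cells lam mu \<longleftrightarrow> (i, j) \<in> skew_cells lam nu \<or> (i, j) \<in> skew_cells nu mu" for i j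
    using le[of "i - 1"] by (cases i) (auto simp: skew_cells_Suc_iff len)
  then show "skew_cells lam mu = skew_cells lam nu \<union> skew_cells nu mu" by auto
  have "\<not> ((i, j) \<in> skew_cells lam nu \<and> (i, j) \<in> skew_cells nu mu)" for i j
    by (cases i) (auto simp: skew_cells_Suc_iff)
  then show "skew_cells lam nu \<inter> skew_cells nu mu = {}" by auto
qed

lemma skew_cells_inj:
  assumes "skew_shape nu mu" "skew_shape nu' mu" "skew_cells nu mu = skew_cells nu' mu"
  shows "nu = nu'"
proof (rule nth_equalityI)
  show len: "length nu = length nu'"
    using assms(1,2) by (simp add: skew_shape_def)
  fix i assume i: "i < length nu"
  have eq: "mu ! i < j \<and> j \<le> nu ! i \<longleftrightarrow> mu ! i < j \<and> j \<le> nu' ! i" for j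
    using assms(3) i len skew_cells_Suc_iff[of i j nu mu] skew_cells_Suc_iff[of i j nu' mu] by simp
  moreover have "mu ! i \<le> nu ! i" "mu ! i \<le> nu' ! i"
    using assms(1,2) i len by (simp_all add: skew_shape_def)
  ultimately show "nu ! i = nu' ! i"
    using eq[of "nu ! i"] eq[of "nu' ! i"] by (metis le_antisym le_neq_implies_less order_refl)
qed

abbreviation cell_maps :: "nat list \<Rightarrow> nat list \<Rightarrow> nat \<Rightarrow> (nat \<times> nat \<Rightarrow> nat) set" where
  "cell_maps lam mu t \<equiv> order_preserving_maps (skew_cells lam mu) (cell_order lam mu) {1..t}"

lemma finite_cell_maps: "finite (cell_maps lam mu t)"
proof (rule finite_subset)
  show "cell_maps lam mu t \<subseteq> skew_cells lam mu \<rightarrow>\<^sub>E {1..t}"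
    by (auto simp: order_preserving_maps_def)
  show "finite (skew_cells lam mu \<rightarrow>\<^sub>E {1..t})"
    by (simp add: finite_PiE finite_skew_cells)
qed

text \<open>A map on the cells of \<open>\<lambda>/\<nu>\<close> becomes a map on those of \<open>\<lambda>/\<mu>\<close> by giving the value \<open>m\<close> to the new cells
  \<open>\<nu>/\<mu>\<close>. These lie at the upper end of the order, so for a new maximal value \<open>m\<close> the map stays order
  preserving.\<close>

definition extend_map :: "nat list \<Rightarrow> nat \<Rightarrow> nat list \<times> (nat \<times> nat \<Rightarrow> nat) \<Rightarrow> nat \<times> nat \<Rightarrow> nat" where
  "extend_map mu m = (\<lambda>(nu, g). \<lambda>x. if x \<in> skew_cells nu mu then m else g x)"

lemma extend_map_in:
  assumes nu: "skew_shape lam nu" "skew_shape nu mu" and g: "g \<in> cell_maps lam nu t"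
  shows "extend_map mu (Suc t) (nu, g) \<in> cell_maps lam mu (Suc t)"
    "{x \<in> skew_cells lam mu. extend_map mu (Suc t) (nu, g) x = Suc t} = skew_cells nu mu"
proof -
  let ?f = "extend_map mu (Suc t) (nu, g)"
  note split = skew_cells_split[OF nu]
  have gP: "g \<in> skew_cells lam nu \<rightarrow>\<^sub>E {1..t}"
    and gmono: "\<And>i j. (i, j) \<in> skew_cells lam nu \<Longrightarrow> (Suc i, j) \<in> skew_cells lam nu \<Longrightarrow> g (Suc i, j) \<le> g (i, j)"
      "\<And>i j. (i, j) \<in> skew_cells lam nu \<Longrightarrow> (i, Suc j) \<in> skew_cells lam nu \<Longrightarrow> g (i, Suc j) \<le> g (i, j)"
    using g by (auto simp: order_preserving_maps_cells_iff)
  have f1: "?f x = Suc t" if "x \<in> skew_cells nu mu" for x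
    using that by (simp add: extend_map_def)
  have f2: "?f x = g x" if "x \<in> skew_cells lam nu" for x
    using that split(2) by (auto simp: extend_map_def)
  have g_bounds: "1 \<le> g x \<and> g x \<le> t" if "x \<in> skew_cells lam nu" for x
    using gP that by fastforce
  have le: "?f x \<le> Suc t" if "x \<in> skew_cells lam mu" for x
    using that f1[of x] f2[of x] g_bounds[of x] split(1) by auto
  have down: "(Suc i, j) \<in> skew_cells lam nu" if "(i, j) \<in> skew_cells lam nu" "(Suc i, j) \<in> skew_cells lam mu" for i j
  proof (cases i)
    case (Suc k)
    have "nu ! Suc k \<le> nu ! k"
      using is_partition_nth[of nu k "Suc k"] nu(1) that Suc by (simp add: skew_shape_def skew_cells_Suc_iff)
    then show ?thesis using that Suc by (simp add: skew_cells_Suc_iff)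
  qed (use that in simp)
  have right: "(i, Suc j) \<in> skew_cells lam nu" if "(i, j) \<in> skew_cells lam nu" "(i, Suc j) \<in> skew_cells lam mu" for i j
    using that by (cases i) (auto simp: skew_cells_Suc_iff)
  have "?f \<in> skew_cells lam mu \<rightarrow>\<^sub>E {1..Suc t}"
  proof
    fix x assume "x \<in> skew_cells lam mu"
    then show "?f x \<in> {1..Suc t}"
      using f1[of x] f2[of x] g_bounds[of x] split(1) by auto
  next
    fix x assume "x \<notin> skew_cells lam mu"
    then show "?f x = undefined"
      using PiE_arb[OF gP, of x] split(1) by (simp add: extend_map_def)
  qed
  moreover have "?f (Suc i, j) \<le> ?f (i, j)" if "(i, j) \<in> skew_cells lam mu" "(Suc i, j) \<in> skew_cells lam mu" for i j
  proof (cases "(i, j) \<in> skew_cells lam nu")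
    case True
    then show ?thesis using down[OF True that(2)] f2 gmono(1) by simp
  next
    case False
    then have "?f (i, j) = Suc t" using that split(1) f1 by blast
    then show ?thesis using le[OF that(2)] by simp
  qed
  moreover have "?f (i, Suc j) \<le> ?f (i, j)" if "(i, j) \<in> skew_cells lam mu" "(i, Suc j) \<in> skew_cells lam mu" for i j
  proof (cases "(i, j) \<in> skew_cells lam nu")
    case True
    then show ?thesis using right[OF True that(2)] f2 gmono(2) by simp
  next
    case False
    then have "?f (i, j) = Suc t" using that split(1) f1 by blast
    then show ?thesis using le[OF that(2)] by simp
  qed
  ultimately show "?f \<in> cell_maps lam mu (Suc t)"
    unfolding order_preserving_maps_cells_iff by blast
  show "{x \<in> skew_cells lam mu. ?f x = Suc t} = skew_cells nu mu"
  proof (intro equalityI subsetI)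
    fix x assume x: "x \<in> {x \<in> skew_cells lam mu. ?f x = Suc t}"
    then have "x \<notin> skew_cells lam nu" using f2[of x] g_bounds[of x] by auto
    with x split(1) show "x \<in> skew_cells nu mu" by blast
  qed (use f1 split(1) in blast)
qed

text \<open>The cells with the maximal value form an up-set of the poset, hence a skew shape \<open>\<nu>/\<mu>\<close>: part \<open>i\<close> of \<open>\<nu>\<close>
  is the last column of row \<open>i\<close> in which that value occurs, or part \<open>i\<close> of \<open>\<mu>\<close> if there is none.\<close>

lemma cell_map_split:
  assumes sh: "skew_shape lam mu" and f: "f \<in> cell_maps lam mu (Suc t)"
  obtains nu g where "skew_shape lam nu" "skew_shape nu mu" "g \<in> cell_maps lam nu t"
    "f = extend_map mu (Suc t) (nu, g)"
proof -
  have lam: "is_partition lam" and mu: "is_partition mu" and len: "length mu = length lam"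
    and le: "\<And>i. i < length lam \<Longrightarrow> mu ! i \<le> lam ! i"
    using sh by (simp_all add: skew_shape_def)
  have fP: "f \<in> skew_cells lam mu \<rightarrow>\<^sub>E {1..Suc t}"
    and down: "\<And>i j. (i, j) \<in> skew_cells lam mu \<Longrightarrow> (Suc i, j) \<in> skew_cells lam mu \<Longrightarrow> f (Suc i, j) \<le> f (i, j)"
    and right: "\<And>i j. (i, j) \<in> skew_cells lam mu \<Longrightarrow> (i, Suc j) \<in> skew_cells lam mu \<Longrightarrow> f (i, Suc j) \<le> f (i, j)"
    using f by (auto simp: order_preserving_maps_cells_iff)
  have bounds: "1 \<le> f x \<and> f x \<le> Suc t" if "x \<in> skew_cells lam mu" for x
    using fP that by fastforce
  have row: "f (Suc i, j') \<le> f (Suc i, j)"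
    if "(Suc i, j) \<in> skew_cells lam mu" "(Suc i, j') \<in> skew_cells lam mu" "j \<le> j'" for i j j'
    using that(3,2)
  proof (induction j' rule: dec_induct)
    case (step k)
    have "(Suc i, k) \<in> skew_cells lam mu"
      using step that(1) by (simp add: skew_cells_Suc_iff)
    then show ?case using right[of "Suc i" k] step by (meson le_trans)
  qed simp
  define S where "S i = {j. (Suc i, j) \<in> skew_cells lam mu \<and> f (Suc i, j) = Suc t}" for i
  define nu where "nu = map (\<lambda>i. Max (insert (mu ! i) (S i))) [0..<length lam]"
  have finS: "finite (S i)" for i
    by (rule finite_subset[of _ "{..lam ! i}"]) (auto simp: S_def skew_cells_Suc_iff)
  have len_nu: "length nu = length lam" by (simp add: nu_def)
  have nu_nth: "nu ! i = Max (insert (mu ! i) (S i))" if "i < length lam" for i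
    using that by (simp add: nu_def)
  have nu_in: "nu ! i = mu ! i \<or> nu ! i \<in> S i" if "i < length lam" for i
    using Max_in[of "insert (mu ! i) (S i)"] finS nu_nth[OF that] by auto
  have nu_ge: "mu ! i \<le> nu ! i" "j \<in> S i \<Longrightarrow> j \<le> nu ! i" if "i < length lam" for i j
    using nu_nth[OF that] finS by auto
  have nu_le: "nu ! i \<le> lam ! i" if "i < length lam" for i
    using nu_in[OF that] le[OF that] by (auto simp: S_def skew_cells_Suc_iff)
  have top: "f (Suc i, j) = Suc t \<longleftrightarrow> j \<le> nu ! i" if cell: "(Suc i, j) \<in> skew_cells lam mu" for i j
  proof
    assume "f (Suc i, j) = Suc t"
    with cell show "j \<le> nu ! i" using nu_ge(2) by (auto simp: S_def skew_cells_Suc_iff)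
  next
    assume j: "j \<le> nu ! i"
    have "mu ! i < nu ! i" "i < length lam" using cell j by (simp_all add: skew_cells_Suc_iff)
    then have "nu ! i \<in> S i" using nu_in by fastforce
    then show "f (Suc i, j) = Suc t"
      using row[OF cell, of "nu ! i"] j bounds[OF cell] by (simp add: S_def)
  qed
  have step: "nu ! Suc i \<le> nu ! i" if i: "Suc i < length lam" for i
  proof (cases "nu ! Suc i \<le> mu ! i")
    case True
    then show ?thesis using nu_ge(1)[of i] i by simp
  next
    case False
    let ?j = "nu ! Suc i"
    have "mu ! Suc i \<le> mu ! i" "lam ! Suc i \<le> lam ! i"
      using is_partition_nth[OF mu, of i "Suc i"] is_partition_nth[OF lam, of i "Suc i"] i len by simp_all
    with False nu_le[OF i] i
    have c1: "(Suc i, ?j) \<in> skew_cells lam mu" and c2: "(Suc (Suc i), ?j) \<in> skew_cells lam mu"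
      by (auto simp: skew_cells_Suc_iff)
    have "f (Suc (Suc i), ?j) = Suc t" using top[OF c2] by simp
    then have "f (Suc i, ?j) = Suc t" using down[OF c1 c2] bounds[OF c1] by simp
    then show ?thesis using top[OF c1] by simp
  qed
  have part_nu: "is_partition nu"
  proof -
    have "nu ! j \<le> nu ! i" if "i < j" "j < length nu" for i j
    proof -
      have "j < length nu \<Longrightarrow> nu ! j \<le> nu ! i"
        using less_imp_le[OF that(1)]
      proof (induction j rule: dec_induct)
        case (step k)
        then show ?case using \<open>\<And>i. Suc i < length lam \<Longrightarrow> nu ! Suc i \<le> nu ! i\<close>[of k] len_nu by simp
      qed simp
      then show ?thesis using that by simp
    qed
    then show ?thesis by (simp add: is_partition_def sorted_wrt_iff_nth_less)
  qed
  have sh1: "skew_shape lam nu" and sh2: "skew_shape nu mu"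
    using lam mu part_nu len len_nu nu_le nu_ge(1) by (simp_all add: skew_shape_def)
  note split = skew_cells_split[OF sh1 sh2]
  define g where "g = restrict f (skew_cells lam nu)"
  have low: "f x \<le> t" if x_in: "x \<in> skew_cells lam nu" for x
  proof -
    obtain i j where x: "x = (Suc i, j)"
      using skew_cellsE[OF x_in] by blast
    have cell: "x \<in> skew_cells lam mu" using x_in split(1) by blast
    have "\<not> j \<le> nu ! i" using x_in by (simp add: x skew_cells_Suc_iff)
    then show ?thesis using top cell bounds[OF cell] by (simp add: x le_Suc_eq)
  qed
  have high: "f x = Suc t" if x_in: "x \<in> skew_cells nu mu" for x
  proof -
    obtain i j where x: "x = (Suc i, j)"
      using skew_cellsE[OF x_in] by blast
    have cell: "x \<in> skew_cells lam mu" using x_in split(1) by blast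
    have "j \<le> nu ! i" using x_in by (simp add: x skew_cells_Suc_iff)
    then show ?thesis using top cell by (simp add: x)
  qed
  have sub: "x \<in> skew_cells lam mu" if "x \<in> skew_cells lam nu" for x
    using that split(1) by blast
  have "g \<in> cell_maps lam nu t"
    unfolding order_preserving_maps_cells_iff
    using low bounds sub down right by (auto simp: g_def)
  moreover have "f = extend_map mu (Suc t) (nu, g)"
  proof
    fix x
    consider "x \<in> skew_cells nu mu" | "x \<in> skew_cells lam nu" "x \<notin> skew_cells nu mu" | "x \<notin> skew_cells lam mu"
      using split(1) by blast
    then show "f x = extend_map mu (Suc t) (nu, g) x"
      using high PiE_arb[OF fP, of x] split(1) by cases (auto simp: extend_map_def g_def)
  qed
  ultimately show ?thesis using that sh1 sh2 by blast
qed

text \<open>Order preserving maps to \<open>{1..t + 1}\<close> are sorted by the region of the value \<open>t + 1\<close>.\<close>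

lemma card_cell_maps_Suc:
  assumes sh: "skew_shape lam mu"
  shows "card (cell_maps lam mu (Suc t)) =
    (\<Sum>nu | skew_shape lam nu \<and> skew_shape nu mu. card (cell_maps lam nu t))"
proof -
  let ?I = "{nu. skew_shape lam nu \<and> skew_shape nu mu}"
  let ?S = "SIGMA nu:?I. cell_maps lam nu t"
  have "bij_betw (extend_map mu (Suc t)) ?S (cell_maps lam mu (Suc t))"
  proof (rule bij_betw_imageI)
    show "inj_on (extend_map mu (Suc t)) ?S"
    proof (rule inj_onI)
      fix p q assume p: "p \<in> ?S" and q: "q \<in> ?S"
        and eq: "extend_map mu (Suc t) p = extend_map mu (Suc t) q"
      obtain nu g where pg: "p = (nu, g)" by (cases p)
      obtain nu' g' where qg: "q = (nu', g')" by (cases q)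
      have P: "skew_shape lam nu" "skew_shape nu mu" "g \<in> cell_maps lam nu t"
        using p by (simp_all add: pg)
      have Q: "skew_shape lam nu'" "skew_shape nu' mu" "g' \<in> cell_maps lam nu' t"
        using q by (simp_all add: qg)
      have "skew_cells nu mu = skew_cells nu' mu"
        using extend_map_in(2)[OF P] extend_map_in(2)[OF Q] eq by (simp add: pg qg)
      then have nu: "nu = nu'" using skew_cells_inj P(2) Q(2) by blast
      have "g x = g' x" for x
      proof (cases "x \<in> skew_cells lam nu")
        case True
        then have "x \<notin> skew_cells nu mu" using skew_cells_split(2)[OF P(1,2)] by blast
        then show ?thesis using fun_cong[OF eq, of x] by (simp add: pg qg extend_map_def nu)
      next
        case False
        moreover have "g \<in> skew_cells lam nu \<rightarrow>\<^sub>E {1..t}" "g' \<in> skew_cells lam nu \<rightarrow>\<^sub>E {1..t}"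
          using P(3) Q(3) by (simp_all add: nu order_preserving_maps_def)
        ultimately show ?thesis using PiE_arb[of g _ _ x] PiE_arb[of g' _ _ x] by metis
      qed
      then show "p = q" using nu pg qg by auto
    qed
    show "extend_map mu (Suc t) ` ?S = cell_maps lam mu (Suc t)"
    proof (intro equalityI subsetI)
      fix f assume "f \<in> cell_maps lam mu (Suc t)"
      from cell_map_split[OF sh this] obtain nu g
        where "skew_shape lam nu" "skew_shape nu mu" "g \<in> cell_maps lam nu t"
          "f = extend_map mu (Suc t) (nu, g)" .
      then show "f \<in> extend_map mu (Suc t) ` ?S" by blast
    next
      fix f assume "f \<in> extend_map mu (Suc t) ` ?S"
      then show "f \<in> cell_maps lam mu (Suc t)"
        using extend_map_in(1) by blast
    qed
  qed
  then have "card (cell_maps lam mu (Suc t)) = card ?S"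
    by (simp add: bij_betw_same_card)
  also have "\<dots> = (\<Sum>nu\<in>?I. card (cell_maps lam nu t))"
  proof (rule card_SigmaI)
    show "finite ?I" by (rule finite_subset[OF _ finite_skew_shapes[of lam]]) blast
  qed (intro ballI finite_cell_maps)
  finally show ?thesis .
qed

lemma card_cell_maps_1: "card (cell_maps lam mu 1) = 1"
proof -
  have "cell_maps lam mu 1 = {restrict (\<lambda>_. 1) (skew_cells lam mu)}"
  proof (intro equalityI subsetI)
    fix f assume "f \<in> cell_maps lam mu 1"
    then have "f \<in> skew_cells lam mu \<rightarrow>\<^sub>E {1..1}" by (simp add: order_preserving_maps_def)
    then show "f \<in> {restrict (\<lambda>_. 1) (skew_cells lam mu)}"
      by (auto simp: PiE_def extensional_def fun_eq_iff)
  qed (auto simp: order_preserving_maps_cells_iff)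
  then show ?thesis by simp
qed

text \<open>The counting recursion is the convolution identity at \<open>s = 1\<close>.\<close>

lemma card_cell_maps:
  assumes "t > 0" "skew_shape lam mu"
  shows "of_nat (card (cell_maps lam mu t)) = poly (kreweras_poly lam mu) (of_nat t)"
  using assms
proof (induction t arbitrary: mu rule: nat_induct_non_zero)
  case 1
  then show ?case using card_cell_maps_1[of lam mu] kreweras_poly_1[of lam mu] by simp
next
  case (Suc t)
  have sh: "is_partition lam" "is_partition mu" "length mu = length lam"
    using Suc.prems by (simp_all add: skew_shape_def)
  have "of_nat (card (cell_maps lam mu (Suc t))) =
      (\<Sum>nu | skew_shape lam nu \<and> skew_shape nu mu. poly (kreweras_poly lam nu) (of_nat t))"
    unfolding card_cell_maps_Suc[OF Suc.prems] of_nat_sum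
    by (rule sum.cong[OF refl]) (use Suc.IH in blast)
  also have "\<dots> = (\<Sum>nu | skew_shape lam nu \<and> skew_shape nu mu.
      poly (kreweras_poly nu mu) 1 * poly (kreweras_poly lam nu) (of_nat t))"
    by (simp add: kreweras_poly_1)
  also have "\<dots> = (\<Sum>nu | skew_shape lam nu.
      poly (kreweras_poly nu mu) 1 * poly (kreweras_poly lam nu) (of_nat t))"
  proof (rule sum.mono_neutral_left[OF finite_skew_shapes])
    show "\<forall>nu\<in>{nu. skew_shape lam nu} - {nu. skew_shape lam nu \<and> skew_shape nu mu}.
        poly (kreweras_poly nu mu) 1 * poly (kreweras_poly lam nu) (of_nat t) = 0"
    proof
      fix nu assume "nu \<in> {nu. skew_shape lam nu} - {nu. skew_shape lam nu \<and> skew_shape nu mu}"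
      then have "skew_shape lam nu" "\<not> skew_shape nu mu" by simp_all
      moreover from this have "kreweras_poly nu mu = 0"
        using sh(2,3) by (intro kreweras_poly_eq_0) (simp_all add: skew_shape_def)
      ultimately show "poly (kreweras_poly nu mu) 1 * poly (kreweras_poly lam nu) (of_nat t) = 0" by simp
    qed
  qed blast
  also have "\<dots> = poly (kreweras_poly lam mu) (1 + of_nat t)"
    by (rule kreweras_convolution[OF sh Suc.hyps, symmetric])
  finally show ?case by simp
qed

lemma order_polynomial_eq_kreweras_poly:
  assumes "skew_shape lam mu"
  shows "order_polynomial (skew_cells lam mu) (cell_order lam mu) = kreweras_poly lam mu"
proof (rule order_polynomial_unique)
  fix t :: nat assume "t > 0"
  then show "poly (order_polynomial (skew_cells lam mu) (cell_order lam mu)) (of_nat t) =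
      poly (kreweras_poly lam mu) (of_nat t)"
    by (simp only: poly_order_polynomial[OF finite_skew_cells partial_order_on_cell_order]
        card_cell_maps[OF _ assms])
qed

theorem theorem1p1:
  fixes lam mu :: "nat list" and n :: nat
  assumes "skew_shape lam mu"
    and "skew_size lam mu = n"
  shows "\<forall>k. coeff (order_polynomial (skew_cells lam mu) (cell_order lam mu)) k \<ge> 0"
  using kreweras_poly_coeff_nonneg[OF assms(1)]
  by (simp add: order_polynomial_eq_kreweras_poly[OF assms(1)])

end
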